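(* Let $k\in\{2,3,4\}$. For every function $g:\mathcal S_k\to\mathbb R$ and all nonnegative reals $\gamma_{1},\ldots,\gamma_{k-1}$, $$\sum_{\sigma\in \mathcal S_k} \sum_{i=1}^{k-1} \gamma_{i} [g(\sigma) - g((ik)\sigma)]^2\ge \sum_{\sigma\in \mathcal S_k} \sum_{1\le i<j\le k-1} \frac{\gamma_{i}\gamma_{j}}{\gamma_{1}+\cdots+\gamma_{k-1}} [g(\sigma) - g((ij)\sigma)]^2 .$$
   Context: $\mathcal S_k$ is the symmetric group on $\{1,\ldots,k\}$; $(ij)$ is the transposition of $i$ and $j$; permutations are multiplied from right to left ($\sigma'\sigma$ means first $\sigma$, then $\sigma'$). An empty sum is zero, and if $\gamma_1=\cdots=\gamma_{k-1}=0$ the fractions are read as $0$. *)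

theory Defs
  imports Complex_Main "HOL-Combinatorics.Permutations"
begin

end

(* Multiply through by s, the sum of the gamma_i, and put gamma_k = -s. The difference of the two
   sides becomes 2 <g, (c - B) g> in the regular representation, where
   B = - sum_{i<j} gamma_i gamma_j (ij), over all i < j \<le> k, and c is the sum of the coefficients
   of B. Now 2 c (c - B) = (c - B)^2 + (c^2 - B^2), so it suffices that c^2 - B^2 is positive
   semidefinite. Since the gamma_i now sum to 0, expanding B^2 gives c^2 = B^2 for k = 3, while for
   k = 4 it gives c^2 - B^2 = gamma_1 gamma_2 gamma_3 s (2 V - Z), where V is the sum of the Klein
   four-group and Z that of the eight 3-cycles. As V + Z is the sum of the alternating group A,
   2 V - Z = 3 V - A is 12 times the difference of the projections onto the V-invariant and the
   A-invariant functions. *)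
theory Submission
  imports Defs
begin

abbreviation (input) tr :: "'a \<Rightarrow> 'a \<Rightarrow> 'a \<Rightarrow> 'a"
  where "tr \<equiv> Transposition.transpose"

text \<open>The inner product of two translates of \<open>g\<close> in the regular representation.
  Keeping both permutations, instead of their quotient alone, lets the squared norm of a combination
  of translates expand term by term without inverses.\<close>

definition corr :: "'a set \<Rightarrow> (('a \<Rightarrow> 'a) \<Rightarrow> real) \<Rightarrow> ('a \<Rightarrow> 'a) \<Rightarrow> ('a \<Rightarrow> 'a) \<Rightarrow> real"
  where "corr S g p q = (\<Sum>\<sigma> | \<sigma> permutes S. g (p \<circ> \<sigma>) * g (q \<circ> \<sigma>))"

lemma corr_commute: "corr S g p q = corr S g q p"
  by (simp add: corr_def mult.commute)

text \<open>The substitution of \<open>r \<circ> \<sigma>\<close> for \<open>\<sigma>\<close> runs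
  over the same group. Hence, for permutations of \<open>S\<close>, only the quotient of
  \<open>q\<close> by \<open>p\<close> matters.\<close>

lemma corr_comp_right:
  assumes "r permutes S"
  shows "corr S g (p \<circ> r) (q \<circ> r) = corr S g p q"
  unfolding corr_def
  using setum_permutations_compose_left[OF assms, of "\<lambda>\<sigma>. g (p \<circ> \<sigma>) * g (q \<circ> \<sigma>)"]
  by (simp add: comp_assoc)

lemma corr_transpose_self:
  assumes "i \<in> S" "j \<in> S"
  shows "corr S g (tr i j) (tr i j) = corr S g id id"
  using corr_comp_right[OF permutes_swap_id[OF assms], of g id id] by simp

lemma corr_transpose_comp:
  assumes "i \<in> S" "j \<in> S"
  shows "corr S g (tr i j) q = corr S g id (q \<circ> tr i j)"
  using corr_comp_right[OF permutes_swap_id[OF assms], of g "tr i j" q] by simp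

text \<open>Right multiplication by the 3-cycle \<open>tr i j \<circ> tr j k\<close> carries (ij) to
  (jk) and (jk) to (ik).\<close>

lemma corr_transpose_rotate:
  assumes "i \<in> S" "j \<in> S" "k \<in> S" "distinct [i, j, k]"
  shows "corr S g (tr i j) (tr j k) = corr S g (tr i k) (tr j k)"
proof -
  have "tr i j \<circ> (tr i j \<circ> tr j k) = tr j k" "tr j k \<circ> (tr i j \<circ> tr j k) = tr i k"
    using assms(4) by (auto simp: fun_eq_iff transpose_def)
  then show ?thesis
    using corr_comp_right[OF permutes_compose[OF permutes_swap_id permutes_swap_id], of j S k i j g "tr i j" "tr j k"]
      assms by (simp add: corr_commute)
qed

lemma sum_square_diff_eq_corr:
  assumes "t permutes S"
  shows "(\<Sum>\<sigma> | \<sigma> permutes S. (g \<sigma> - g (t \<circ> \<sigma>))\<^sup>2) = 2 * corr S g id id - 2 * corr S g id t"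
proof -
  have "(\<Sum>\<sigma> | \<sigma> permutes S. (g \<sigma> - g (t \<circ> \<sigma>))\<^sup>2)
      = corr S g id id + corr S g t t - 2 * corr S g id t"
    by (simp add: corr_def power2_eq_square algebra_simps sum.distrib sum_subtractf sum_distrib_left)
  then show ?thesis
    using corr_comp_right[OF assms, of g id id] by simp
qed

text \<open>This is the squared norm of the combination of translates of \<open>g\<close> that
  \<open>L\<close> encodes. A list of coefficients and permutations is used so that a concrete
  \<open>L\<close> unfolds by simplification.\<close>

lemma corr_quadratic_form_nonneg:
  "0 \<le> (\<Sum>(x, p)\<leftarrow>L. \<Sum>(y, q)\<leftarrow>L. x * y * corr S g p q)"
proof -
  have lin: "(\<Sum>\<sigma> | \<sigma> permutes S. f \<sigma> * (\<Sum>(y, q)\<leftarrow>M. y * g (q \<circ> \<sigma>)))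
      = (\<Sum>(y, q)\<leftarrow>M. y * (\<Sum>\<sigma> | \<sigma> permutes S. f \<sigma> * g (q \<circ> \<sigma>)))" for f M
    by (induction M) (auto simp: algebra_simps sum.distrib sum_distrib_left)
  \<comment> \<open>The two factors are decoupled so that the induction runs over the left one with
    \<open>L\<close> fixed; \<open>M = L\<close> then gives a square.\<close>
  have "(\<Sum>\<sigma> | \<sigma> permutes S. (\<Sum>(x, p)\<leftarrow>M. x * g (p \<circ> \<sigma>)) * (\<Sum>(y, q)\<leftarrow>L. y * g (q \<circ> \<sigma>)))
      = (\<Sum>(x, p)\<leftarrow>M. \<Sum>(y, q)\<leftarrow>L. x * y * corr S g p q)" for M
  proof (induction M)
    case (Cons m M)
    obtain x p where m: "m = (x, p)" by fastforce
    have "(\<Sum>\<sigma> | \<sigma> permutes S. x * g (p \<circ> \<sigma>) * (\<Sum>(y, q)\<leftarrow>L. y * g (q \<circ> \<sigma>)))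
        = (\<Sum>(y, q)\<leftarrow>L. x * y * corr S g p q)"
      unfolding lin corr_def
      by (intro arg_cong[of _ _ sum_list] map_cong refl)
        (auto simp: sum_distrib_left mult_ac split: prod.splits)
    with Cons.IH show ?case
      by (simp only: m list.map sum_list.Cons prod.case distrib_right sum.distrib)
  qed simp
  from this[of L] show ?thesis
    by (metis (no_types, lifting) sum_nonneg zero_le_square)
qed

text \<open>This is half of the positivity of 2 V - Z. The right side runs over the Klein four-group
  on i, j, k, l; the left side has one 3-cycle for each three of these points, its inverse giving
  the same value by symmetry.\<close>

lemma corr_klein_ge_3cycles:
  assumes "i \<in> S" "j \<in> S" "k \<in> S" "l \<in> S" and dist: "distinct [i, j, k, l]"
  shows "corr S g (tr i j) (tr j k) + corr S g (tr i j) (tr j l)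
         + corr S g (tr i k) (tr k l) + corr S g (tr j k) (tr k l)
       \<le> corr S g id id + corr S g (tr i j) (tr k l) + corr S g (tr i k) (tr j l)
         + corr S g (tr i l) (tr j k)"
proof -
  let ?P = "{\<sigma>. \<sigma> permutes S}"
  define p q r where "p = tr i j \<circ> tr k l" and "q = tr i k \<circ> tr j l" and "r = tr i l \<circ> tr j k"
  define z z' where "z = tr i j \<circ> tr j k" and "z' = tr j k \<circ> tr i j"
  note defs = p_def q_def r_def z_def z'_def
  have perm: "p permutes S" "q permutes S" "r permutes S" "z permutes S" "z' permutes S"
    unfolding defs using assms by (auto intro!: permutes_compose permutes_swap_id)
  have rel: "p \<circ> p = id" "q \<circ> q = id" "r \<circ> r = id"
      "p \<circ> q = r" "q \<circ> p = r" "p \<circ> r = q" "r \<circ> p = q" "q \<circ> r = p" "r \<circ> q = p"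
    and conj: "z \<circ> p = r \<circ> z" "z \<circ> q = p \<circ> z" "z \<circ> r = q \<circ> z"
      "z' \<circ> p = q \<circ> z'" "z' \<circ> q = r \<circ> z'" "z' \<circ> r = p \<circ> z'"
    and inv: "z' \<circ> z = id"
    unfolding defs using dist by (auto simp: fun_eq_iff transpose_def)
  \<comment> \<open>With \<open>u = V g\<close>, the claim is that a quarter of the sum of \<open>(u \<sigma> - u (z \<circ> \<sigma>))\<^sup>2\<close> is nonnegative,
    as \<open>V\<close> and its two other cosets \<open>V z\<close>, \<open>V z'\<close> exhaust the alternating group.\<close>
  define u where "u \<sigma> = g \<sigma> + g (p \<circ> \<sigma>) + g (q \<circ> \<sigma>) + g (r \<circ> \<sigma>)" for \<sigma>
  \<comment> \<open>\<open>F\<close> is (2 V - Z) g, since V z and V z' together contain all eight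
    3-cycles.\<close>
  define F where "F \<sigma> = 2 * u \<sigma> - u (z \<circ> \<sigma>) - u (z' \<circ> \<sigma>)" for \<sigma>
  have u_inv: "u (p \<circ> \<sigma>) = u \<sigma>" "u (q \<circ> \<sigma>) = u \<sigma>" "u (r \<circ> \<sigma>) = u \<sigma>" for \<sigma>
    by (simp_all add: u_def comp_assoc[symmetric] rel)
  have u_conj: "u (z \<circ> (p \<circ> \<sigma>)) = u (z \<circ> \<sigma>)" "u (z \<circ> (q \<circ> \<sigma>)) = u (z \<circ> \<sigma>)"
      "u (z \<circ> (r \<circ> \<sigma>)) = u (z \<circ> \<sigma>)" "u (z' \<circ> (p \<circ> \<sigma>)) = u (z' \<circ> \<sigma>)"
      "u (z' \<circ> (q \<circ> \<sigma>)) = u (z' \<circ> \<sigma>)" "u (z' \<circ> (r \<circ> \<sigma>)) = u (z' \<circ> \<sigma>)" for \<sigma>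
    by (metis comp_assoc conj u_inv)+
  have F_inv: "F (p \<circ> \<sigma>) = F \<sigma>" "F (q \<circ> \<sigma>) = F \<sigma>" "F (r \<circ> \<sigma>) = F \<sigma>" for \<sigma>
    by (simp_all add: F_def u_inv u_conj)
  have shift: "(\<Sum>\<sigma>\<in>?P. f (v \<circ> \<sigma>)) = (\<Sum>\<sigma>\<in>?P. f \<sigma>)" if "v permutes S" for f :: "_ \<Rightarrow> real" and v
    using setum_permutations_compose_left[OF that, of f] by simp
  \<comment> \<open>As \<open>F\<close> is V-invariant, the four terms of \<open>u\<close>
    contribute equally after reindexing.\<close>
  have "u \<sigma> * F \<sigma> = g \<sigma> * F \<sigma> + g (p \<circ> \<sigma>) * F (p \<circ> \<sigma>)
      + g (q \<circ> \<sigma>) * F (q \<circ> \<sigma>) + g (r \<circ> \<sigma>) * F (r \<circ> \<sigma>)" for \<sigma>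
    by (simp add: F_inv) (simp add: u_def distrib_right)
  then have "(\<Sum>\<sigma>\<in>?P. u \<sigma> * F \<sigma>) = 4 * (\<Sum>\<sigma>\<in>?P. g \<sigma> * F \<sigma>)"
    using shift[OF perm(1), of "\<lambda>\<sigma>. g \<sigma> * F \<sigma>"] shift[OF perm(2), of "\<lambda>\<sigma>. g \<sigma> * F \<sigma>"]
      shift[OF perm(3), of "\<lambda>\<sigma>. g \<sigma> * F \<sigma>"]
    by (simp add: sum.distrib)
  moreover have "(\<Sum>\<sigma>\<in>?P. u \<sigma> * F \<sigma>) = (\<Sum>\<sigma>\<in>?P. (u \<sigma> - u (z \<circ> \<sigma>))\<^sup>2)"
  proof -
    have "(\<Sum>\<sigma>\<in>?P. u \<sigma> * u (z' \<circ> \<sigma>)) = (\<Sum>\<sigma>\<in>?P. u \<sigma> * u (z \<circ> \<sigma>))"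
      using shift[OF perm(4), of "\<lambda>\<sigma>. u \<sigma> * u (z' \<circ> \<sigma>)"]
      by (simp add: comp_assoc[symmetric] inv mult.commute)
    moreover have "(\<Sum>\<sigma>\<in>?P. u (z \<circ> \<sigma>) * u (z \<circ> \<sigma>)) = (\<Sum>\<sigma>\<in>?P. u \<sigma> * u \<sigma>)"
      using shift[OF perm(4), of "\<lambda>\<sigma>. u \<sigma> * u \<sigma>"] by simp
    moreover have "u \<sigma> * F \<sigma> = 2 * (u \<sigma> * u \<sigma>) - u \<sigma> * u (z \<circ> \<sigma>) - u \<sigma> * u (z' \<circ> \<sigma>)"
        "(u \<sigma> - u (z \<circ> \<sigma>))\<^sup>2 = u \<sigma> * u \<sigma> + u (z \<circ> \<sigma>) * u (z \<circ> \<sigma>) - 2 * (u \<sigma> * u (z \<circ> \<sigma>))" for \<sigma>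
      by (simp_all add: F_def power2_eq_square algebra_simps)
    ultimately show ?thesis
      by (simp add: sum.distrib sum_subtractf flip: sum_distrib_left)
  qed
  ultimately have nonneg: "0 \<le> (\<Sum>\<sigma>\<in>?P. g \<sigma> * F \<sigma>)"
    by (smt (verit) sum_nonneg zero_le_power2)
  \<comment> \<open>The factorizations are ordered so that \<open>corr_transpose_comp\<close>, read
    backwards, yields the terms of the claim up to symmetry.\<close>
  have cyc: "p \<circ> z = tr k l \<circ> tr j k" "q \<circ> z = tr j l \<circ> tr i j" "r \<circ> z = tr i k \<circ> tr k l"
      "p \<circ> z' = tr k l \<circ> tr i k" "q \<circ> z' = tr j k \<circ> tr k l" "r \<circ> z' = tr i j \<circ> tr j l"
    unfolding defs using dist by (auto simp: fun_eq_iff transpose_def)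
  have klein: "p = tr k l \<circ> tr i j" "q = tr j l \<circ> tr i k" "r = tr j k \<circ> tr i l"
    unfolding defs using dist by (auto simp: fun_eq_iff transpose_def)
  have "(\<Sum>\<sigma>\<in>?P. g \<sigma> * F \<sigma>)
      = 2 * (corr S g id id + corr S g id p + corr S g id q + corr S g id r)
        - (corr S g id z + corr S g id (p \<circ> z) + corr S g id (q \<circ> z) + corr S g id (r \<circ> z))
        - (corr S g id z' + corr S g id (p \<circ> z') + corr S g id (q \<circ> z') + corr S g id (r \<circ> z'))"
    by (simp add: F_def u_def corr_def comp_assoc algebra_simps sum.distrib sum_subtractf
        sum_distrib_left)
  with nonneg show ?thesis
    unfolding cyc unfolding klein z_def z'_def using assms(1-4)
    by (simp add: corr_transpose_comp[symmetric]) (simp add: corr_commute)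
qed

text \<open>All quotients here are the two mutually inverse 3-cycles on i, j, k. As rewrite rules,
  the equations give 3-cycle terms one normal form, so that their coefficients can be
  collected.\<close>

lemma corr_3cycle_eq:
  assumes "i \<in> S" "j \<in> S" "k \<in> S" "distinct [i, j, k]"
  shows "corr S g (tr j k) (tr i j) = corr S g (tr i j) (tr j k)"
    and "corr S g (tr i k) (tr j k) = corr S g (tr i j) (tr j k)"
    and "corr S g (tr j k) (tr i k) = corr S g (tr i j) (tr j k)"
    and "corr S g (tr i j) (tr i k) = corr S g (tr i j) (tr j k)"
    and "corr S g (tr i k) (tr i j) = corr S g (tr i j) (tr j k)"
  using corr_transpose_rotate[of i S j k g] corr_transpose_rotate[of k S j i g]
    corr_transpose_rotate[of j S i k g] assms
  by (auto simp: corr_commute transpose_commute)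

lemma octopus_3:
  fixes g :: "('a \<Rightarrow> 'a) \<Rightarrow> real"
  assumes "i \<in> S" "j \<in> S" "n \<in> S" "distinct [i, j, n]" and nonneg: "0 \<le> a" "0 \<le> b"
  defines "W \<equiv> \<lambda>x y. \<Sum>\<sigma> | \<sigma> permutes S. (g \<sigma> - g (tr x y \<circ> \<sigma>))\<^sup>2"
  shows "a * b * W i j / (a + b) \<le> a * W i n + b * W j n"
\<comment> \<open>If the weights vanish, division by zero gives 0, as the statement
  prescribes.\<close>
proof (cases "a + b = 0")
  case False
  define C where "C = a\<^sup>2 + b\<^sup>2 + a * b"
  define X where "X = (a + b) * (a * W i n + b * W j n) - a * b * W i j"
  have W: "W x y = 2 * corr S g id id - 2 * corr S g id (tr x y)" if "x \<in> S" "y \<in> S" for x y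
    unfolding W_def by (rule sum_square_diff_eq_corr[OF permutes_swap_id[OF that]])
  \<comment> \<open>The list encodes C - B, and X = 2 <g, (C - B) g>. Since C^2 = B^2 here,
    \<open>C * X\<close> is exactly the squared norm of (C - B) g.\<close>
  have "0 \<le> C * X"
    using corr_quadratic_form_nonneg[where S = S and g = g and L = "[(C, id), (a * b, tr i j), (- a * (a + b), tr i n),
        (- b * (a + b), tr j n)]"] assms(1-4)
    by (simp add: corr_3cycle_eq[of i S j n] corr_transpose_self corr_commute[of S g "tr _ _" id] X_def W)
      (simp add: C_def power2_eq_square algebra_simps)
  moreover have "0 < C"
  proof -
    have "0 < a\<^sup>2 + b\<^sup>2"
      using False by (auto simp: sum_power2_gt_zero_iff)
    then show ?thesis
      using nonneg by (simp add: C_def add_pos_nonneg)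
  qed
  ultimately have "0 \<le> X"
    by (simp add: zero_le_mult_iff)
  moreover have "0 < a + b"
    using nonneg False by simp
  ultimately show ?thesis
    by (simp add: X_def pos_divide_le_eq mult.commute)
qed (use nonneg in \<open>auto simp: W_def sum_nonneg\<close>)

lemma octopus_4:
  fixes g :: "('a \<Rightarrow> 'a) \<Rightarrow> real"
  assumes "i \<in> S" "j \<in> S" "k \<in> S" "n \<in> S" "distinct [i, j, k, n]"
    and nonneg: "0 \<le> a" "0 \<le> b" "0 \<le> c"
  defines "W \<equiv> \<lambda>x y. \<Sum>\<sigma> | \<sigma> permutes S. (g \<sigma> - g (tr x y \<circ> \<sigma>))\<^sup>2"
  shows "(a * b * W i j + a * c * W i k + b * c * W j k) / (a + b + c)
       \<le> a * W i n + b * W j n + c * W k n"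
proof (cases "a + b + c = 0")
  case False
  define s where "s = a + b + c"
  define C where "C = a\<^sup>2 + b\<^sup>2 + c\<^sup>2 + a * b + a * c + b * c"
  define X where "X = s * (a * W i n + b * W j n + c * W k n)
    - (a * b * W i j + a * c * W i k + b * c * W j k)"
  define K where "K = corr S g id id + corr S g (tr i j) (tr k n) + corr S g (tr i k) (tr j n)
         + corr S g (tr i n) (tr j k)
       - (corr S g (tr i j) (tr j k) + corr S g (tr i j) (tr j n)
         + corr S g (tr i k) (tr k n) + corr S g (tr j k) (tr k n))"
  have W: "W x y = 2 * corr S g id id - 2 * corr S g id (tr x y)" if "x \<in> S" "y \<in> S" for x y
    unfolding W_def by (rule sum_square_diff_eq_corr[OF permutes_swap_id[OF that]])
  have s: "0 < s"
    using nonneg False by (simp add: s_def)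
  have "0 \<le> K"
    using corr_klein_ge_3cycles[of i S j k n g] assms(1-5) by (simp add: K_def)
  then have K: "0 \<le> 2 * (a * b * c * s) * K"
    using nonneg s by simp
  define N where "N = (\<Sum>(x, p)\<leftarrow>[(C, id), (a * b, tr i j), (a * c, tr i k), (b * c, tr j k),
      (- a * s, tr i n), (- b * s, tr j n), (- c * s, tr k n)].
      \<Sum>(y, q)\<leftarrow>[(C, id), (a * b, tr i j), (a * c, tr i k), (b * c, tr j k),
      (- a * s, tr i n), (- b * s, tr j n), (- c * s, tr k n)]. x * y * corr S g p q)"
  have "0 \<le> N"
    unfolding N_def by (rule corr_quadratic_form_nonneg)
  \<comment> \<open>\<open>N\<close> is the squared norm of (C - B) g; the \<open>K\<close> term is
    <g, (C^2 - B^2) g>.\<close>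
  moreover have "C * X = N + 2 * (a * b * c * s) * K"
    unfolding N_def using assms(1-5)
    by (simp add: corr_3cycle_eq[of i S j k] corr_3cycle_eq[of i S j n] corr_3cycle_eq[of i S k n]
        corr_3cycle_eq[of j S k n] corr_transpose_self corr_commute[of S g "tr _ _" id]
        corr_commute[of S g "tr k n" "tr i j"] corr_commute[of S g "tr j n" "tr i k"]
        corr_commute[of S g "tr j k" "tr i n"] X_def W K_def)
      (simp add: C_def s_def power2_eq_square algebra_simps)
  ultimately have "0 \<le> C * X"
    using K by simp
  moreover have "0 < C"
  proof -
    have "0 < s\<^sup>2" using s by simp
    \<comment> \<open>Adding the two relations gives 2 C \<ge> s^2 > 0.\<close>
    moreover have "C = s\<^sup>2 - (a * b + a * c + b * c)" "C \<ge> a * b + a * c + b * c"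
      using sum_squares_ge_zero[of "a - b" "b - c"] sum_squares_ge_zero[of "a - c" 0] nonneg
      by (auto simp: C_def s_def power2_eq_square algebra_simps)
    ultimately show ?thesis by linarith
  qed
  ultimately have "0 \<le> X"
    by (simp add: zero_le_mult_iff)
  then show ?thesis
    using s by (simp add: X_def pos_divide_le_eq mult.commute flip: s_def)
qed (use nonneg in \<open>auto simp: W_def sum_nonneg add_nonneg_eq_0_iff\<close>)

theorem mainTheorem3:
  fixes k :: nat and g :: "(nat \<Rightarrow> nat) \<Rightarrow> real" and \<gamma> :: "nat \<Rightarrow> real"
  assumes "k \<in> {2, 3, 4}"
    and "\<And>i. i \<in> {1..k - 1} \<Longrightarrow> 0 \<le> \<gamma> i"
  shows "(\<Sum>\<sigma> | \<sigma> permutes {1..k}. \<Sum>i = 1..k - 1.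
            \<gamma> i * (g \<sigma> - g (Transposition.transpose i k \<circ> \<sigma>))\<^sup>2)
       \<ge> (\<Sum>\<sigma> | \<sigma> permutes {1..k}. \<Sum>(i, j) \<in> {(i, j). 1 \<le> i \<and> i < j \<and> j \<le> k - 1}.
            \<gamma> i * \<gamma> j / (\<Sum>l = 1..k - 1. \<gamma> l)
              * (g \<sigma> - g (Transposition.transpose i j \<circ> \<sigma>))\<^sup>2)"
proof -
  \<comment> \<open>Once the sums are exchanged, \<open>g\<close> enters both sides only through
    \<open>W\<close>.\<close>
  define W where "W x y = (\<Sum>\<sigma> | \<sigma> permutes {1..k}. (g \<sigma> - g (tr x y \<circ> \<sigma>))\<^sup>2)" for x y
  have l: "(\<Sum>\<sigma> | \<sigma> permutes {1..k}. \<Sum>i = 1..k - 1. \<gamma> i * (g \<sigma> - g (tr i k \<circ> \<sigma>))\<^sup>2)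
      = (\<Sum>i = 1..k - 1. \<gamma> i * W i k)"
    unfolding W_def sum_distrib_left by (rule sum.swap)
  have r: "(\<Sum>\<sigma> | \<sigma> permutes {1..k}. \<Sum>(i, j) \<in> A. c i j * (g \<sigma> - g (tr i j \<circ> \<sigma>))\<^sup>2)
      = (\<Sum>(i, j) \<in> A. c i j * W i j)" for A c
    unfolding W_def sum_distrib_left case_prod_unfold by (rule sum.swap)
  have "(\<Sum>(i, j) \<in> {(i, j). 1 \<le> i \<and> i < j \<and> j \<le> k - 1}. \<gamma> i * \<gamma> j / (\<Sum>l = 1..k - 1. \<gamma> l) * W i j)
      \<le> (\<Sum>i = 1..k - 1. \<gamma> i * W i k)"
  proof -
    consider "k = 2" | "k = 3" | "k = 4" using assms(1) by blast
    then show ?thesis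
    proof cases
      case 1
      then have pairs: "{(i, j). 1 \<le> i \<and> i < j \<and> j \<le> k - 1} = {}" by auto
      have "0 \<le> W 1 k" by (simp add: W_def sum_nonneg)
      then show ?thesis using 1 assms(2)[of 1] unfolding pairs by simp
    next
      case 2
      then have pairs: "{(i, j). 1 \<le> i \<and> i < j \<and> j \<le> k - 1} = {(1, 2)}" by auto
      have legs: "{1..k - 1} = {1, 2}" using 2 by auto
      show ?thesis
        unfolding pairs legs
        using octopus_3[of 1 "{1..k}" 2 3 "\<gamma> 1" "\<gamma> 2" g] assms(2) 2 by (simp add: W_def)
    next
      case 3
      then have pairs: "{(i, j). 1 \<le> i \<and> i < j \<and> j \<le> k - 1} = {(1, 2), (1, 3), (2, 3)}" by auto
      have legs: "{1..k - 1} = {1, 2, 3}" using 3 by auto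
      show ?thesis
        unfolding pairs legs using octopus_4[of 1 "{1..k}" 2 3 4 "\<gamma> 1" "\<gamma> 2" "\<gamma> 3" g] assms(2) 3
        by (simp add: W_def add_divide_distrib add.assoc)
    qed
  qed
  then show ?thesis
    by (simp only: l r)
qed

end
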